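(* Let $G$ be a connected $k$-regular graph on $n$ vertices, $k\geq 3$, with adjacency eigenvalues $k=\lambda_{1}>\lambda_{2}\ge \dots\ge \lambda_{n}$ and edge-connectivity $\kappa'$. If $\tau$ is a positive real number with $\tau\leq \kappa'/k$ and $\lambda_{2}<k-\frac{\tau k}{k+1}$, then $t(G)\ge \tau$.
   Context: All graphs are finite, simple and undirected. For a connected graph $G$ and a vertex subset $S$, $c(G\setminus S)$ denotes the number of connected components of the graph obtained from $G$ by removing the vertices of $S$. The toughness of $G$ is $t(G)=\min_S \frac{|S|}{c(G\setminus S)}$, the minimum being over all vertex subsets $S$ whose removal disconnects $G$ (i.e. $c(G\setminus S)\ge 2$). If $G$ is complete (no such $S$ exists), then $t(G)=+\infty$ by convention. The edge-connectivity $\kappa'$ of $G$ is the minimum number of edges whose removal disconnects $G$. *)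

theory Defs
  imports
    "HOL-Library.Extended_Real"
    "Graph_Theory.Digraph_Component"
    "Jordan_Normal_Form.Char_Poly"
begin

text \<open>
  A finite simple undirected graph is a \<^locale>\<open>pair_graph\<close>: a finite loop-free digraph whose arcs
  are a symmetric set of ordered pairs, so that the undirected edge \<open>uv\<close> is represented by the two
  arcs \<open>(u, v)\<close> and \<open>(v, u)\<close>.
\<close>

definition regular :: "'a pair_pre_digraph \<Rightarrow> nat \<Rightarrow> bool" where
  "regular G k \<longleftrightarrow> (\<forall>v \<in> pverts G. out_degree (with_proj G) v = k)"

definition remove_verts :: "'a pair_pre_digraph \<Rightarrow> 'a set \<Rightarrow> ('a, 'a \<times> 'a) pre_digraph" where
  "remove_verts G S = with_proj G \<restriction> (pverts G - S)"

text \<open>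
  The arcs are symmetric, so the strongly connected components are the connected components of
  the undirected graph.
\<close>

definition num_components :: "('a, 'b) pre_digraph \<Rightarrow> nat" where
  "num_components H = card (pre_digraph.sccs_verts H)"

text \<open>
  The infimum ranges over a finite set. If that set is nonempty, the infimum is a minimum; if it is
  empty, i.e. if \<open>G\<close> is complete, the infimum is \<open>\<infinity>\<close>, which is the usual convention.
\<close>

definition toughness :: "'a pair_pre_digraph \<Rightarrow> ereal" where
  "toughness G =
     (INF S \<in> {S. S \<subseteq> pverts G \<and> num_components (remove_verts G S) \<ge> 2}.
        ereal (real (card S) / real (num_components (remove_verts G S))))"

text \<open>Edges are two-element sets, so that each undirected edge is counted once.\<close>

definition edges :: "'a pair_pre_digraph \<Rightarrow> 'a set set" where
  "edges G = {{u, v} | u v. (u, v) \<in> parcs G}"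

definition remove_edges :: "'a pair_pre_digraph \<Rightarrow> 'a set set \<Rightarrow> 'a pair_pre_digraph" where
  "remove_edges G F = \<lparr> pverts = pverts G, parcs = {(u, v) \<in> parcs G. {u, v} \<notin> F} \<rparr>"

text \<open>
  The set is nonempty, and so the minimum meaningful, as soon as \<open>G\<close> has at least two vertices.
  The qualified name \<open>Digraph_Component.connected\<close> is graph connectedness, not the topological
  notion.
\<close>

definition edge_connectivity :: "'a pair_pre_digraph \<Rightarrow> nat" where
  "edge_connectivity G =
     Min {card F | F. F \<subseteq> edges G \<and>
                     \<not> Digraph_Component.connected (with_proj (remove_edges G F))}"

text \<open>The vertices are \<open>v 0, \<dots>, v (n - 1)\<close>.\<close>

definition adjacency_matrix :: "nat \<Rightarrow> (nat \<Rightarrow> 'a) \<Rightarrow> 'a pair_pre_digraph \<Rightarrow> real mat" where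
  "adjacency_matrix n v G = mat n n (\<lambda>(i, j). if (v i, v j) \<in> parcs G then 1 else 0)"

text \<open>
  The real eigenvalues in non-increasing order, repeated according to their algebraic multiplicity
  (\<^const>\<open>proots\<close> is the multiset of roots). For a real symmetric \<open>n \<times> n\<close> matrix the list has
  length \<open>n\<close>. Lists are indexed from \<open>0\<close>, so \<open>eigenvalues A ! (i - 1)\<close> is the \<open>i\<close>-th largest
  eigenvalue.
\<close>

definition eigenvalues :: "real mat \<Rightarrow> real list" where
  "eigenvalues A = rev (sorted_list_of_multiset (proots (char_poly A)))"

end

theory Submission
  imports Defs
begin

text \<open>
  Every regular graph of degree \<open>k > 0\<close> satisfies \<open>t(G) \<ge> \<kappa>' / k\<close>. Indeed, if removing \<open>S\<close> leaves \<open>c \<ge> 2\<close> components, then the edges leaving any one of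
  them form an edge cut, so there are at least \<open>\<kappa>'\<close> of them, and they all end in \<open>S\<close>. Distinct
  components give disjoint sets of edges, and at most \<open>k |S|\<close> edges meet \<open>S\<close>, so \<open>c \<kappa>' \<le> k |S|\<close>.
\<close>

lemma (in pair_fin_digraph) finite_edges: "finite (edges G)"
proof -
  have "edges G = (\<lambda>(u, v). {u, v}) ` parcs G"
    unfolding edges_def by auto
  then show ?thesis
    using pair_finite_arcs by simp
qed

lemma (in pair_fin_digraph) edge_connectivity_le_card:
  assumes "F \<subseteq> edges G" "\<not> Digraph_Component.connected (with_proj (remove_edges G F))"
  shows "edge_connectivity G \<le> card F"
proof -
  have "{card F | F. F \<subseteq> edges G \<and> \<not> Digraph_Component.connected (with_proj (remove_edges G F))}
      \<subseteq> card ` Pow (edges G)"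
    by auto
  then have "finite {card F | F. F \<subseteq> edges G \<and>
      \<not> Digraph_Component.connected (with_proj (remove_edges G F))}"
    by (rule finite_subset) (simp add: finite_edges)
  then show ?thesis
    unfolding edge_connectivity_def using assms by (intro Min_le) auto
qed

text \<open>A walk starting in \<open>X\<close> can never leave it, so \<open>w\<close> is
  unreachable from \<open>u\<close>.\<close>

lemma not_connected_if_no_crossing_arc:
  assumes "u \<in> X" "u \<in> pverts H" "w \<in> pverts H" "w \<notin> X"
    and closed: "\<And>a b. (a, b) \<in> parcs H \<Longrightarrow> a \<in> X \<longleftrightarrow> b \<in> X"
  shows "\<not> Digraph_Component.connected (with_proj H)"
proof
  assume "Digraph_Component.connected (with_proj H)"
  then have "u \<rightarrow>\<^sup>*\<^bsub>with_proj (mk_symmetric (with_proj H))\<^esub> w"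
    using assms(2,3) unfolding connected_def strongly_connected_def by simp
  then have "(u, w) \<in> (parcs (mk_symmetric (with_proj H)))\<^sup>*"
    using reachable_rtranclI by fastforce
  then have "w \<in> X"
  proof induction
    case base
    show ?case using assms(1) .
  next
    case (step a b)
    \<comment> \<open>Connectedness is defined through the symmetric closure, so the walk may use an
      arc backwards; \<open>closed\<close> is an equivalence and covers both directions.\<close>
    then show ?case using closed by (auto simp: parcs_mk_symmetric)
  qed
  with assms(4) show False by simp
qed

text \<open>Deleting the edges between \<open>X\<close> and its nonempty complement separates the
  two. The boundary is counted by arcs entering \<open>X\<close>, so that each edge is represented
  once and its head tells on which side it ends.\<close>

lemma (in pair_graph) edge_connectivity_le_boundary:
  assumes "X \<noteq> {}" "X \<subset> pverts G"
  shows "edge_connectivity G \<le> card {(u, w) \<in> parcs G. u \<notin> X \<and> w \<in> X}"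
proof -
  let ?B = "{(u, w) \<in> parcs G. u \<notin> X \<and> w \<in> X}"
  let ?F = "(\<lambda>(u, w). {u, w}) ` ?B"
  obtain x y where x: "x \<in> X" and y: "y \<in> pverts G" "y \<notin> X"
    using assms by blast
  have "\<not> Digraph_Component.connected (with_proj (remove_edges G ?F))"
  proof (rule not_connected_if_no_crossing_arc[of x X _ y])
    fix a b assume ab: "(a, b) \<in> parcs (remove_edges G ?F)"
    then have arcs: "(a, b) \<in> parcs G" "(b, a) \<in> parcs G"
      by (auto simp: remove_edges_def intro: arcs_symmetric)
    have "{a, b} \<notin> ?F"
      using ab by (simp add: remove_edges_def)
    \<comment> \<open>Both orientations give the same unordered pair, so neither can lie in
      \<open>?B\<close>.\<close>
    then have "(a, b) \<notin> ?B" "(b, a) \<notin> ?B"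
      by (force simp: insert_commute)+
    with arcs show "a \<in> X \<longleftrightarrow> b \<in> X"
      by auto
  qed (use x y assms in \<open>auto simp: remove_edges_def\<close>)
  moreover have "?F \<subseteq> edges G"
    unfolding edges_def by auto
  ultimately have "edge_connectivity G \<le> card ?F"
    by (intro edge_connectivity_le_card)
  also have "\<dots> \<le> card ?B"
    by (rule card_image_le, rule finite_subset[OF _ pair_finite_arcs]) auto
  finally show ?thesis .
qed

text \<open>If \<open>u\<close> were outside \<open>S\<close>, the arc and its reverse would both
  survive the removal, making \<open>u\<close> and \<open>w\<close> mutually reachable and hence
  members of the same component.\<close>

lemma (in pair_graph) component_boundary_in_removed:
  assumes "X \<in> pre_digraph.sccs_verts (remove_verts G S)"
    and "(u, w) \<in> parcs G" "u \<notin> X" "w \<in> X" "w \<in> pverts G - S"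
  shows "u \<in> S"
proof (rule ccontr)
  assume "u \<notin> S"
  interpret H: wf_digraph "remove_verts G S"
    unfolding remove_verts_def by (rule wellformed_induce_subgraph)
  have "u \<in> pverts G"
    using assms(2) by (rule in_arcsD1)
  with \<open>u \<notin> S\<close> assms(2,5) arcs_symmetric[OF assms(2)]
  have "(u, w) \<in> arcs_ends (remove_verts G S)" "(w, u) \<in> arcs_ends (remove_verts G S)"
    unfolding remove_verts_def by (auto simp: arcs_ends_conv)
  then have "u \<rightarrow>\<^sup>*\<^bsub>remove_verts G S\<^esub> w" "w \<rightarrow>\<^sup>*\<^bsub>remove_verts G S\<^esub> u"
    by auto
  with assms(1,3,4) show False
    unfolding H.in_sccs_verts_conv_reachable by blast
qed

text \<open>Double counting of the arcs that enter components: grouped by the component of the head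
  they give the lower bound, grouped by the tail in \<open>S\<close> the upper one.\<close>

lemma (in pair_graph) edge_connectivity_num_components_le:
  assumes "regular G k" "S \<subseteq> pverts G" "num_components (remove_verts G S) \<ge> 2"
  shows "edge_connectivity G * num_components (remove_verts G S) \<le> k * card S"
proof -
  interpret H: wf_digraph "remove_verts G S"
    unfolding remove_verts_def by (rule wellformed_induce_subgraph)
  let ?C = "pre_digraph.sccs_verts (remove_verts G S)"
  let ?B = "\<lambda>X. {(u, w) \<in> parcs G. u \<notin> X \<and> w \<in> X}"
  have sub: "X \<subseteq> pverts G - S" if "X \<in> ?C" for X
    using H.sccs_verts_subsets[OF that] by (simp add: remove_verts_def)
  have card_C: "card ?C \<ge> 2"
    using assms(3) by (simp add: num_components_def)
  have boundary: "edge_connectivity G \<le> card (?B X)" if X: "X \<in> ?C" for X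
  proof (rule edge_connectivity_le_boundary)
    show nonempty: "X \<noteq> {}"
      using X by (simp add: H.in_sccs_verts_conv_reachable)
    \<comment> \<open>A second component supplies a vertex outside \<open>X\<close>, so
      \<open>X\<close> is a proper subset.\<close>
    obtain Y where Y: "Y \<in> ?C" "Y \<noteq> X"
      using card_C by (metis One_nat_def card.empty card_1_singleton_iff card_le_Suc0_iff_eq
          card.infinite not_less_eq_eq numeral_2_eq_2 X zero_le)
    then have "Y \<noteq> {}" "X \<inter> Y = {}"
      using H.sccs_verts_disjoint[OF X Y(1)] by (auto simp: H.in_sccs_verts_conv_reachable)
    with sub[OF X] sub[OF Y(1)] show "X \<subset> pverts G"
      by blast
  qed
  \<comment> \<open>An infinite set would have \<open>card\<close> equal to 0.\<close>
  have fin_C: "finite ?C"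
    using card_C card.infinite by fastforce
  have fin_B: "finite (?B X)" for X
    by (rule finite_subset[OF _ pair_finite_arcs]) auto
  have fin_S: "finite S"
    using assms(2) pair_finite_verts by (rule finite_subset)
  have "edge_connectivity G * card ?C \<le> (\<Sum>X\<in>?C. card (?B X))"
    using sum_bounded_below[of ?C "edge_connectivity G" "\<lambda>X. card (?B X)"] boundary
    by (simp add: mult.commute)
  also have "\<dots> = card (\<Union>X\<in>?C. ?B X)"
  proof (rule card_UN_disjoint[symmetric])
    \<comment> \<open>The head of an arc lies in at most one component.\<close>
    show "\<forall>X\<in>?C. \<forall>Y\<in>?C. X \<noteq> Y \<longrightarrow> ?B X \<inter> ?B Y = {}"
      using H.sccs_verts_disjoint by fast
  qed (use fin_C fin_B in auto)
  also have "\<dots> \<le> card (\<Union>s\<in>S. out_arcs (with_proj G) s)"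
  proof (rule card_mono)
    show "finite (\<Union>s\<in>S. out_arcs (with_proj G) s)"
      using fin_S by auto
    show "(\<Union>X\<in>?C. ?B X) \<subseteq> (\<Union>s\<in>S. out_arcs (with_proj G) s)"
      using component_boundary_in_removed[of _ S] sub by fastforce
  qed
  also have "\<dots> \<le> (\<Sum>s\<in>S. card (out_arcs (with_proj G) s))"
    by (rule card_UN_le[OF fin_S])
  also have "\<dots> = k * card S"
    using assms(1,2) by (simp add: regular_def out_degree_def subset_iff mult.commute)
  finally show ?thesis
    by (simp add: num_components_def)
qed

text \<open>The counting inequality, divided by \<open>k\<close> and by the number of components,
  bounds every ratio in the infimum. For complete graphs the infimum is over the empty set and
  \<open>INF_greatest\<close> applies vacuously.\<close>

lemma (in pair_graph) toughness_ge_edge_connectivity: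
  assumes "regular G k" "k > 0"
  shows "ereal (real (edge_connectivity G) / real k) \<le> toughness G"
  unfolding toughness_def
proof (rule INF_greatest)
  fix S assume "S \<in> {S. S \<subseteq> pverts G \<and> num_components (remove_verts G S) \<ge> 2}"
  then have S: "S \<subseteq> pverts G" and c: "num_components (remove_verts G S) \<ge> 2"
    by auto
  have "real (edge_connectivity G) * real (num_components (remove_verts G S))
      \<le> real k * real (card S)"
    using edge_connectivity_num_components_le[OF assms(1) S c]
    by (metis of_nat_le_iff of_nat_mult)
  then have "real (edge_connectivity G) / real k
      \<le> real (card S) / real (num_components (remove_verts G S))"
    using assms(2) c by (simp add: field_simps)
  then show "ereal (real (edge_connectivity G) / real k)
      \<le> ereal (real (card S) / real (num_components (remove_verts G S)))"
    by simp
qed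

theorem theorem1p4:
  fixes G :: "'a pair_pre_digraph" and v :: "nat \<Rightarrow> 'a" and n k :: nat and \<tau> :: real
  assumes "pair_graph G"
    and "Digraph_Component.connected (with_proj G)"
    and "bij_betw v {0..<n} (pverts G)"
    and "regular G k"
    and "k \<ge> 3"
    and "\<tau> > 0"
    and "\<tau> \<le> real (edge_connectivity G) / real k"
    and "eigenvalues (adjacency_matrix n v G) ! 1 < real k - \<tau> * real k / (real k + 1)"
  shows "toughness G \<ge> ereal \<tau>"
proof -
  have "ereal \<tau> \<le> ereal (real (edge_connectivity G) / real k)"
    using assms(7) by simp
  also have "\<dots> \<le> toughness G"
    using assms(1,4,5) by (intro pair_graph.toughness_ge_edge_connectivity) auto
  finally show ?thesis .
qed

end
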